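(* Let $S$ and $R$ be rings and let $f:S\rightarrow R$ be a (not necessarily unitary) ring homomorphism with $f[S]\subseteq Z(R)$. Assume that $f$ satisfies LO, INC, GD, GU and SGB. Let $\mathcal D$ denote a chain of prime ideals in $\mathrm{Spec}(S)$. Then there exists a perfect maximal cover of $\mathcal D$. Moreover, any maximal $\mathcal D$-chain is a perfect maximal cover of $\mathcal D$.
   Context: Rings are nontrivial, associative, with identity, not necessarily commutative; homomorphisms need not send $1$ to $1$. $Z(R)$ is the center of $R$. $\mathrm{Spec}$ denotes the set of prime (two-sided, proper) ideals: $P$ is prime if $aRb\subseteq P$ implies $a\in P$ or $b\in P$. $\subset$ means proper inclusion. All chains are with respect to containment. An ideal $Q$ of $R$ lies over an ideal $P$ of $S$ if $f^{-1}[Q]=P$. (For $Q\in\mathrm{Spec}(R)$, $f^{-1}[Q]$ is either a prime ideal of $S$ or equal to $S$.) LO: for all $P\in\mathrm{Spec}(S)$ there is $Q\in\mathrm{Spec}(R)$ lying over $P$. INC: whenever $Q_1\subset Q_2$ in $\mathrm{Spec}(R)$ and $f^{-1}[Q_2]\neq S$, we have $f^{-1}[Q_1]\subset f^{-1}[Q_2]$. GD: for any $P_1\subset P_2$ in $\mathrm{Spec}(S)$ and every $Q_2\in\mathrm{Spec}(R)$ lying over $P_2$, there is $Q_1\subset Q_2$ in $\mathrm{Spec}(R)$ lying over $P_1$. GU: for any $P_1\subset P_2$ in $\mathrm{Spec}(S)$ and every $Q_1\in\mathrm{Spec}(R)$ lying over $P_1$, there is $Q_2\in\mathrm{Spec}(R)$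 with $Q_1\subset Q_2$ lying over $P_2$. SGB: for any $P_1\subset P_2\subset P_3$ in $\mathrm{Spec}(S)$ and every $Q_1\subset Q_3$ in $\mathrm{Spec}(R)$ with $Q_1$ lying over $P_1$ and $Q_3$ lying over $P_3$, there is $Q_2\in\mathrm{Spec}(R)$ with $Q_1\subset Q_2\subset Q_3$ lying over $P_2$. For a chain $\mathcal D\subseteq\mathrm{Spec}(S)$, a $\mathcal D$-chain is a chain $\mathcal C\subseteq\mathrm{Spec}(R)$ with $f^{-1}[Q]\in\mathcal D$ for every $Q\in\mathcal C$. A maximal $\mathcal D$-chain is a $\mathcal D$-chain that is maximal, with respect to containment, among $\mathcal D$-chains. A $\mathcal D$-chain $\mathcal C$ is a cover of $\mathcal D$ if the map $Q\mapsto f^{-1}[Q]$ from $\mathcal C$ to $\mathcal D$ is surjective, and a perfect cover if this map is bijective; a maximal cover is a cover of $\mathcal D$ which is maximal with respect to containment; a perfect maximal cover is a maximal cover that is a perfect cover. *)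

theory Defs
  imports "HOL-Algebra.Ideal"
begin

text \<open>Rings are those of HOL-Algebra: associative, with identity, not necessarily commutative.
  The library's \<^term>\<open>ring_hom\<close> requires preservation of \<open>\<one>\<close>, and its \<^locale>\<open>primeideal\<close>
  presupposes a commutative ring, so neither applies here.\<close>

definition nonunital_ring_hom ::
    "('a, 'm) ring_scheme \<Rightarrow> ('b, 'n) ring_scheme \<Rightarrow> ('a \<Rightarrow> 'b) set" where
  "nonunital_ring_hom S R =
     {f \<in> carrier S \<rightarrow> carrier R.
        \<forall>x\<in>carrier S. \<forall>y\<in>carrier S.
          f (x \<oplus>\<^bsub>S\<^esub> y) = f x \<oplus>\<^bsub>R\<^esub> f y \<and> f (x \<otimes>\<^bsub>S\<^esub> y) = f x \<otimes>\<^bsub>R\<^esub> f y}"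

definition ring_center :: "('a, 'm) ring_scheme \<Rightarrow> 'a set" where
  "ring_center R = {z \<in> carrier R. \<forall>x\<in>carrier R. z \<otimes>\<^bsub>R\<^esub> x = x \<otimes>\<^bsub>R\<^esub> z}"

definition prime_spectrum :: "('a, 'm) ring_scheme \<Rightarrow> 'a set set" where
  "prime_spectrum R =
     {P. ideal P R \<and> P \<noteq> carrier R \<and>
         (\<forall>a\<in>carrier R. \<forall>b\<in>carrier R.
            (\<forall>r\<in>carrier R. a \<otimes>\<^bsub>R\<^esub> r \<otimes>\<^bsub>R\<^esub> b \<in> P) \<longrightarrow> a \<in> P \<or> b \<in> P)}"

text \<open>The preimage \<open>f\<^sup>-\<^sup>1[Q]\<close>, relative to the carrier of \<open>S\<close>.\<close>

definition contraction :: "('a, 'm) ring_scheme \<Rightarrow> ('a \<Rightarrow> 'b) \<Rightarrow> 'b set \<Rightarrow> 'a set" where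
  "contraction S f Q = {s \<in> carrier S. f s \<in> Q}"

definition lies_over ::
    "('a, 'm) ring_scheme \<Rightarrow> ('a \<Rightarrow> 'b) \<Rightarrow> 'b set \<Rightarrow> 'a set \<Rightarrow> bool" where
  "lies_over S f Q P \<longleftrightarrow> contraction S f Q = P"

definition lying_over ::
    "('a, 'm) ring_scheme \<Rightarrow> ('b, 'n) ring_scheme \<Rightarrow> ('a \<Rightarrow> 'b) \<Rightarrow> bool" where
  "lying_over S R f \<longleftrightarrow>
     (\<forall>P\<in>prime_spectrum S. \<exists>Q\<in>prime_spectrum R. lies_over S f Q P)"

definition incomparability ::
    "('a, 'm) ring_scheme \<Rightarrow> ('b, 'n) ring_scheme \<Rightarrow> ('a \<Rightarrow> 'b) \<Rightarrow> bool" where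
  "incomparability S R f \<longleftrightarrow>
     (\<forall>Q1\<in>prime_spectrum R. \<forall>Q2\<in>prime_spectrum R.
        Q1 \<subset> Q2 \<and> contraction S f Q2 \<noteq> carrier S \<longrightarrow>
        contraction S f Q1 \<subset> contraction S f Q2)"

definition going_down ::
    "('a, 'm) ring_scheme \<Rightarrow> ('b, 'n) ring_scheme \<Rightarrow> ('a \<Rightarrow> 'b) \<Rightarrow> bool" where
  "going_down S R f \<longleftrightarrow>
     (\<forall>P1\<in>prime_spectrum S. \<forall>P2\<in>prime_spectrum S. \<forall>Q2\<in>prime_spectrum R.
        P1 \<subset> P2 \<and> lies_over S f Q2 P2 \<longrightarrow>
        (\<exists>Q1\<in>prime_spectrum R. Q1 \<subset> Q2 \<and> lies_over S f Q1 P1))"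

definition going_up ::
    "('a, 'm) ring_scheme \<Rightarrow> ('b, 'n) ring_scheme \<Rightarrow> ('a \<Rightarrow> 'b) \<Rightarrow> bool" where
  "going_up S R f \<longleftrightarrow>
     (\<forall>P1\<in>prime_spectrum S. \<forall>P2\<in>prime_spectrum S. \<forall>Q1\<in>prime_spectrum R.
        P1 \<subset> P2 \<and> lies_over S f Q1 P1 \<longrightarrow>
        (\<exists>Q2\<in>prime_spectrum R. Q1 \<subset> Q2 \<and> lies_over S f Q2 P2))"

text \<open>The property SGB.\<close>

definition strong_going_between ::
    "('a, 'm) ring_scheme \<Rightarrow> ('b, 'n) ring_scheme \<Rightarrow> ('a \<Rightarrow> 'b) \<Rightarrow> bool" where
  "strong_going_between S R f \<longleftrightarrow>
     (\<forall>P1\<in>prime_spectrum S. \<forall>P2\<in>prime_spectrum S. \<forall>P3\<in>prime_spectrum S.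
      \<forall>Q1\<in>prime_spectrum R. \<forall>Q3\<in>prime_spectrum R.
        P1 \<subset> P2 \<and> P2 \<subset> P3 \<and> Q1 \<subset> Q3 \<and> lies_over S f Q1 P1 \<and> lies_over S f Q3 P3 \<longrightarrow>
        (\<exists>Q2\<in>prime_spectrum R. Q1 \<subset> Q2 \<and> Q2 \<subset> Q3 \<and> lies_over S f Q2 P2))"

text \<open>In the following, \<open>D\<close> is a chain in \<^term>\<open>prime_spectrum S\<close>. Chains may be empty.\<close>

definition chain_over ::
    "('a, 'm) ring_scheme \<Rightarrow> ('b, 'n) ring_scheme \<Rightarrow> ('a \<Rightarrow> 'b) \<Rightarrow> 'a set set \<Rightarrow> 'b set set \<Rightarrow> bool"
  where
  "chain_over S R f D C \<longleftrightarrow>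
     subset.chain (prime_spectrum R) C \<and> (\<forall>Q\<in>C. contraction S f Q \<in> D)"

definition maximal_chain_over ::
    "('a, 'm) ring_scheme \<Rightarrow> ('b, 'n) ring_scheme \<Rightarrow> ('a \<Rightarrow> 'b) \<Rightarrow> 'a set set \<Rightarrow> 'b set set \<Rightarrow> bool"
  where
  "maximal_chain_over S R f D C \<longleftrightarrow>
     chain_over S R f D C \<and> \<not> (\<exists>C'. chain_over S R f D C' \<and> C \<subset> C')"

definition cover ::
    "('a, 'm) ring_scheme \<Rightarrow> ('b, 'n) ring_scheme \<Rightarrow> ('a \<Rightarrow> 'b) \<Rightarrow> 'a set set \<Rightarrow> 'b set set \<Rightarrow> bool"
  where
  "cover S R f D C \<longleftrightarrow> chain_over S R f D C \<and> contraction S f ` C = D"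

definition perfect_cover ::
    "('a, 'm) ring_scheme \<Rightarrow> ('b, 'n) ring_scheme \<Rightarrow> ('a \<Rightarrow> 'b) \<Rightarrow> 'a set set \<Rightarrow> 'b set set \<Rightarrow> bool"
  where
  "perfect_cover S R f D C \<longleftrightarrow> chain_over S R f D C \<and> bij_betw (contraction S f) C D"

text \<open>Maximality is among covers of \<open>D\<close>; since a \<open>D\<close>-chain containing a cover is again a cover,
  this is the same as maximality among \<open>D\<close>-chains.\<close>

definition maximal_cover ::
    "('a, 'm) ring_scheme \<Rightarrow> ('b, 'n) ring_scheme \<Rightarrow> ('a \<Rightarrow> 'b) \<Rightarrow> 'a set set \<Rightarrow> 'b set set \<Rightarrow> bool"
  where
  "maximal_cover S R f D C \<longleftrightarrow>
     cover S R f D C \<and> \<not> (\<exists>C'. cover S R f D C' \<and> C \<subset> C')"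

definition perfect_maximal_cover ::
    "('a, 'm) ring_scheme \<Rightarrow> ('b, 'n) ring_scheme \<Rightarrow> ('a \<Rightarrow> 'b) \<Rightarrow> 'a set set \<Rightarrow> 'b set set \<Rightarrow> bool"
  where
  "perfect_maximal_cover S R f D C \<longleftrightarrow> maximal_cover S R f D C \<and> perfect_cover S R f D C"

end

theory Submission
  imports Defs "HOL-Algebra.Ring_Divisibility"
begin

text \<open>Incomparability makes contraction injective on any \<open>D\<close>-chain. If a maximal \<open>D\<close>-chain \<open>C\<close>
  missed some \<open>P \<in> D\<close>, split it into the members \<open>L\<close> contracting below \<open>P\<close> and the members \<open>U\<close>
  contracting above \<open>P\<close>. The intersection of \<open>U\<close> is prime. The union \<open>A\<close> of \<open>L\<close> need not be prime
  in a noncommutative ring, but its contraction \<open>A\<^sub>0\<close> is, because central elements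
  behave as in a commutative ring. The products of elements of \<open>f[S \<setminus> A\<^sub>0]\<close> with elements
  outside \<open>\<Inter>U\<close> form an m-system disjoint from \<open>A\<close>, so some prime over \<open>A\<^sub>0\<close> lies between \<open>A\<close>
  and \<open>\<Inter>U\<close>. LO, GD, GU or SGB now inserts a prime over \<open>P\<close> between \<open>L\<close> and \<open>U\<close>, contradicting
  maximality. Existence of maximal \<open>D\<close>-chains is Hausdorff's principle.\<close>

section \<open>Prime ideals and m-systems in noncommutative rings\<close>

context ring
begin

text \<open>Closure under negation comes from the identity: the negative of \<open>a\<close> is the
  negative of \<open>\<one>\<close> times \<open>a\<close>.\<close>

lemma idealI_mult_closed:
  assumes "I \<subseteq> carrier R" "I \<noteq> {}"
    and add: "\<And>x y. x \<in> I \<Longrightarrow> y \<in> I \<Longrightarrow> x \<oplus> y \<in> I"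
    and l: "\<And>a x. a \<in> I \<Longrightarrow> x \<in> carrier R \<Longrightarrow> x \<otimes> a \<in> I"
    and r: "\<And>a x. a \<in> I \<Longrightarrow> x \<in> carrier R \<Longrightarrow> a \<otimes> x \<in> I"
  shows "ideal I R"
proof (rule idealI[OF ring_axioms])
  show "subgroup I (add_monoid R)"
  proof (rule add.subgroupI)
    fix a assume "a \<in> I"
    moreover have "\<ominus> a = (\<ominus> \<one>) \<otimes> a"
      using \<open>a \<in> I\<close> assms(1) l_minus[of \<one> a] by auto
    ultimately show "\<ominus> a \<in> I"
      using l by auto
  qed (use assms in auto)
qed (use l r in auto)

text \<open>The middle factor \<open>r\<close> makes the set two-sided: for \<open>x\<close> in it,
  \<open>(x y) r b = x (y r) b\<close>. The bare condition that \<open>x b\<close> lies in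
  \<open>Q\<close> would in general give only a left ideal. This set and its mirror image below
  contain \<open>Q\<close> and serve to enlarge it.\<close>

lemma ideal_left_annihilator:
  assumes Q: "ideal Q R" and b: "b \<in> carrier R"
  shows "ideal {x \<in> carrier R. \<forall>r\<in>carrier R. x \<otimes> r \<otimes> b \<in> Q} R"
proof -
  interpret Q: ideal Q R by fact
  show ?thesis
  proof (rule idealI_mult_closed)
    show "{x \<in> carrier R. \<forall>r\<in>carrier R. x \<otimes> r \<otimes> b \<in> Q} \<noteq> {}"
      using b by (auto intro!: exI[of _ \<zero>])
  next
    fix x y assume x: "x \<in> {x \<in> carrier R. \<forall>r\<in>carrier R. x \<otimes> r \<otimes> b \<in> Q}" and y: "y \<in> carrier R"
    have "x \<otimes> y \<otimes> r \<otimes> b \<in> Q" if "r \<in> carrier R" for r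
    proof -
      have "x \<otimes> (y \<otimes> r) \<otimes> b \<in> Q" using x y that by auto
      then show ?thesis using x y b that by (simp add: m_assoc)
    qed
    then show "x \<otimes> y \<in> {x \<in> carrier R. \<forall>r\<in>carrier R. x \<otimes> r \<otimes> b \<in> Q}"
      using x y by auto
  qed (use b in \<open>auto simp: l_distr m_assoc intro: Q.a_closed Q.I_l_closed\<close>)
qed

lemma ideal_right_annihilator:
  assumes Q: "ideal Q R" and a: "a \<in> carrier R"
  shows "ideal {x \<in> carrier R. \<forall>r\<in>carrier R. a \<otimes> r \<otimes> x \<in> Q} R"
proof -
  interpret Q: ideal Q R by fact
  show ?thesis
  proof (rule idealI_mult_closed)
    show "{x \<in> carrier R. \<forall>r\<in>carrier R. a \<otimes> r \<otimes> x \<in> Q} \<noteq> {}"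
      using a by (auto intro!: exI[of _ \<zero>])
  next
    fix x y assume x: "x \<in> {x \<in> carrier R. \<forall>r\<in>carrier R. a \<otimes> r \<otimes> x \<in> Q}" and y: "y \<in> carrier R"
    have "a \<otimes> r \<otimes> (y \<otimes> x) \<in> Q" if "r \<in> carrier R" for r
    proof -
      have "a \<otimes> (r \<otimes> y) \<otimes> x \<in> Q" using x y that by auto
      then show ?thesis using x y a that by (simp add: m_assoc)
    qed
    then show "y \<otimes> x \<in> {x \<in> carrier R. \<forall>r\<in>carrier R. a \<otimes> r \<otimes> x \<in> Q}"
      using x y by auto
  next
    fix x y assume x: "x \<in> {x \<in> carrier R. \<forall>r\<in>carrier R. a \<otimes> r \<otimes> x \<in> Q}" and y: "y \<in> carrier R"
    have "a \<otimes> r \<otimes> (x \<otimes> y) \<in> Q" if "r \<in> carrier R" for r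
    proof -
      have "a \<otimes> r \<otimes> x \<otimes> y \<in> Q" using x y that by (auto intro: Q.I_r_closed)
      then show ?thesis using x y a that by (simp add: m_assoc)
    qed
    then show "x \<otimes> y \<in> {x \<in> carrier R. \<forall>r\<in>carrier R. a \<otimes> r \<otimes> x \<in> Q}"
      using x y by auto
  qed (use a in \<open>auto simp: r_distr intro: Q.a_closed\<close>)
qed

text \<open>If \<open>a\<close> and \<open>b\<close> violate primeness, \<open>Q\<close> is enlarged
  twice. The left annihilator of \<open>b\<close> modulo \<open>Q\<close> properly contains
  \<open>Q\<close> because of \<open>a\<close>, so it meets \<open>M\<close> in some
  \<open>m\<close>. The right annihilator of \<open>m\<close> then properly contains
  \<open>Q\<close> because of \<open>b\<close>, so it meets \<open>M\<close> in some
  \<open>n\<close>. Now every \<open>m r n\<close> lies in \<open>Q\<close>, although one of them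
  must lie in \<open>M\<close>.\<close>

lemma maximal_disjoint_ideal_is_prime:
  assumes M: "M \<subseteq> carrier R" "M \<noteq> {}"
    and m_system: "\<And>x y. x \<in> M \<Longrightarrow> y \<in> M \<Longrightarrow> \<exists>r\<in>carrier R. x \<otimes> r \<otimes> y \<in> M"
    and Q: "ideal Q R" "Q \<inter> M = {}"
    and maximal: "\<And>I. ideal I R \<Longrightarrow> Q \<subset> I \<Longrightarrow> I \<inter> M \<noteq> {}"
  shows "Q \<in> prime_spectrum R"
proof -
  interpret Q: ideal Q R by fact
  have "a \<in> Q \<or> b \<in> Q"
    if a: "a \<in> carrier R" and b: "b \<in> carrier R" and ab: "\<forall>r\<in>carrier R. a \<otimes> r \<otimes> b \<in> Q" for a b
  proof (rule ccontr)
    assume *: "\<not> (a \<in> Q \<or> b \<in> Q)"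
    have "Q \<subset> {x \<in> carrier R. \<forall>r\<in>carrier R. x \<otimes> r \<otimes> b \<in> Q}"
      using * a b ab Q.a_subset by (auto intro: Q.I_r_closed)
    then obtain m where m: "m \<in> M" and mb: "\<forall>r\<in>carrier R. m \<otimes> r \<otimes> b \<in> Q"
      using maximal[OF ideal_left_annihilator[OF Q(1) b]] by blast
    have mR: "m \<in> carrier R" using m M by blast
    have "Q \<subset> {x \<in> carrier R. \<forall>r\<in>carrier R. m \<otimes> r \<otimes> x \<in> Q}"
      using * b mb mR Q.a_subset by (auto intro: Q.I_l_closed)
    then obtain n where "n \<in> M" "\<forall>r\<in>carrier R. m \<otimes> r \<otimes> n \<in> Q"
      using maximal[OF ideal_right_annihilator[OF Q(1) mR]] by blast
    then show False
      using m_system[OF m] Q(2) by blast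
  qed
  then show ?thesis
    using M Q unfolding prime_spectrum_def by blast
qed

text \<open>Zorn's lemma applies to the ideals that contain \<open>A\<close> and avoid
  \<open>M\<close>, since both conditions pass to unions of nonempty chains.\<close>

lemma exists_prime_disjoint_from_m_system:
  assumes M: "M \<subseteq> carrier R" "M \<noteq> {}"
    and m_system: "\<And>x y. x \<in> M \<Longrightarrow> y \<in> M \<Longrightarrow> \<exists>r\<in>carrier R. x \<otimes> r \<otimes> y \<in> M"
    and A: "ideal A R" "A \<inter> M = {}"
  shows "\<exists>Q\<in>prime_spectrum R. A \<subseteq> Q \<and> Q \<inter> M = {}"
proof -
  let ?F = "{I. ideal I R \<and> A \<subseteq> I \<and> I \<inter> M = {}}"
  have "\<exists>Q\<in>?F. \<forall>I\<in>?F. Q \<subseteq> I \<longrightarrow> I = Q"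
  proof (rule subset_Zorn_nonempty)
    show "?F \<noteq> {}" using A by blast
  next
    fix \<C> assume \<C>: "\<C> \<noteq> {}" "subset.chain ?F \<C>"
    then have "subset.chain {I. ideal I R} \<C>"
      unfolding subset_chain_def by blast
    from chain_Union_is_ideal[OF this] have "ideal (\<Union>\<C>) R" using \<C>(1) by simp
    then show "\<Union>\<C> \<in> ?F"
      using \<C> unfolding subset_chain_def by blast
  qed
  then obtain Q where Q: "Q \<in> ?F" and max: "\<forall>I\<in>?F. Q \<subseteq> I \<longrightarrow> I = Q" ..
  have "Q \<in> prime_spectrum R"
  proof (rule maximal_disjoint_ideal_is_prime[OF M m_system])
    show "ideal Q R" "Q \<inter> M = {}" using Q by blast+
    show "I \<inter> M \<noteq> {}" if "ideal I R" "Q \<subset> I" for I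
      using that Q max by blast
  qed
  then show ?thesis using Q by blast
qed

lemma prime_spectrum_Inter_chain:
  assumes C: "subset.chain (prime_spectrum R) C" "C \<noteq> {}"
  shows "\<Inter>C \<in> prime_spectrum R"
proof -
  have prime: "P \<in> prime_spectrum R" if "P \<in> C" for P
    using C(1) that unfolding subset_chain_def by blast
  have "ideal (\<Inter>C) R"
    by (rule i_Intersect) (use prime C in \<open>auto simp: prime_spectrum_def\<close>)
  moreover have "\<Inter>C \<noteq> carrier R"
  proof -
    obtain P where P: "P \<in> C" using C(2) by blast
    then have "P \<subseteq> carrier R" "P \<noteq> carrier R"
      using prime[OF P] ideal.axioms(1) additive_subgroup.a_subset
      unfolding prime_spectrum_def by blast+
    then show ?thesis using P by blast
  qed
  moreover have "a \<in> \<Inter>C \<or> b \<in> \<Inter>C"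
    if "a \<in> carrier R" "b \<in> carrier R" and ab: "\<forall>r\<in>carrier R. a \<otimes> r \<otimes> b \<in> \<Inter>C" for a b
  proof (rule ccontr)
    assume "\<not> (a \<in> \<Inter>C \<or> b \<in> \<Inter>C)"
    \<comment> \<open>Some member misses \<open>a\<close> and some member misses \<open>b\<close>;
      the smaller of the two misses both.\<close>
    then obtain P where P: "P \<in> C" "a \<notin> P" "b \<notin> P"
      using C(1) unfolding subset_chain_def by blast
    then show False
      using prime[OF P(1)] that unfolding prime_spectrum_def by blast
  qed
  ultimately show ?thesis
    unfolding prime_spectrum_def by blast
qed

text \<open>For central \<open>z\<close>, \<open>z r x = r (z x)\<close>, so one product in
  \<open>Q\<close> puts all of them in \<open>Q\<close>. Central elements thus see \<open>Q\<close>
  as a prime of a commutative ring.\<close>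

lemma prime_spectrum_center_mult:
  assumes Q: "Q \<in> prime_spectrum R" and z: "z \<in> ring_center R"
    and x: "x \<in> carrier R" and zx: "z \<otimes> x \<in> Q"
  shows "z \<in> Q \<or> x \<in> Q"
proof -
  have zR: "z \<in> carrier R" using z by (simp add: ring_center_def)
  have "z \<otimes> r \<otimes> x \<in> Q" if r: "r \<in> carrier R" for r
  proof -
    have "z \<otimes> r \<otimes> x = r \<otimes> (z \<otimes> x)"
      using z r x zR by (simp add: ring_center_def m_assoc)
    then show ?thesis
      using Q r zx ideal.I_l_closed unfolding prime_spectrum_def by fastforce
  qed
  then show ?thesis
    using Q x zR unfolding prime_spectrum_def by blast
qed

end

section \<open>Contraction along a central homomorphism\<close>

locale central_ring_hom = S: ring S + R: ring R
  for S :: "('a, 'm) ring_scheme" and R :: "('b, 'n) ring_scheme" +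
  fixes f :: "'a \<Rightarrow> 'b"
  assumes hom: "f \<in> nonunital_ring_hom S R"
    and central: "f ` carrier S \<subseteq> ring_center R"
begin

lemma map_closed: "x \<in> carrier S \<Longrightarrow> f x \<in> carrier R"
  and map_add: "x \<in> carrier S \<Longrightarrow> y \<in> carrier S \<Longrightarrow> f (x \<oplus>\<^bsub>S\<^esub> y) = f x \<oplus>\<^bsub>R\<^esub> f y"
  and map_mult: "x \<in> carrier S \<Longrightarrow> y \<in> carrier S \<Longrightarrow> f (x \<otimes>\<^bsub>S\<^esub> y) = f x \<otimes>\<^bsub>R\<^esub> f y"
  using hom by (auto simp: nonunital_ring_hom_def)

lemma map_center: "x \<in> carrier S \<Longrightarrow> f x \<in> ring_center R"
  using central by blast

lemma map_commute: "x \<in> carrier S \<Longrightarrow> r \<in> carrier R \<Longrightarrow> f x \<otimes>\<^bsub>R\<^esub> r = r \<otimes>\<^bsub>R\<^esub> f x"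
  using map_center by (simp add: ring_center_def)

lemma map_zero: "f \<zero>\<^bsub>S\<^esub> = \<zero>\<^bsub>R\<^esub>"
  using map_add[of "\<zero>\<^bsub>S\<^esub>" "\<zero>\<^bsub>S\<^esub>"] map_closed[of "\<zero>\<^bsub>S\<^esub>"] by simp

lemma contraction_ideal:
  assumes "ideal Q R"
  shows "ideal (contraction S f Q) S"
proof -
  interpret Q: ideal Q R by fact
  show ?thesis
  proof (rule S.idealI_mult_closed)
    show "contraction S f Q \<noteq> {}"
      using map_zero Q.zero_closed by (force simp: contraction_def)
  qed (auto simp: contraction_def map_add map_mult map_closed
        intro: Q.a_closed Q.I_l_closed Q.I_r_closed)
qed

lemma contraction_mult:
  assumes "Q \<in> prime_spectrum R" "x \<in> carrier S" "y \<in> carrier S"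
    and "x \<otimes>\<^bsub>S\<^esub> y \<in> contraction S f Q"
  shows "x \<in> contraction S f Q \<or> y \<in> contraction S f Q"
  using R.prime_spectrum_center_mult[OF assms(1) map_center[OF assms(2)] map_closed[OF assms(3)]]
    assms by (auto simp: contraction_def map_mult)

lemma contraction_prime:
  assumes Q: "Q \<in> prime_spectrum R" and proper: "contraction S f Q \<noteq> carrier S"
  shows "contraction S f Q \<in> prime_spectrum S"
proof -
  have "a \<in> contraction S f Q \<or> b \<in> contraction S f Q"
    if a: "a \<in> carrier S" and b: "b \<in> carrier S"
      and ab: "\<forall>r\<in>carrier S. a \<otimes>\<^bsub>S\<^esub> r \<otimes>\<^bsub>S\<^esub> b \<in> contraction S f Q" for a b
  proof -
    \<comment> \<open>Any \<open>s\<close> outside the contraction can be the middle factor: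
      splitting \<open>(a s) b\<close> and then \<open>a s\<close> leaves only \<open>a\<close> or
      \<open>b\<close>.\<close>
    obtain s where s: "s \<in> carrier S" "s \<notin> contraction S f Q"
      using proper by (auto simp: contraction_def)
    have "a \<otimes>\<^bsub>S\<^esub> s \<in> contraction S f Q \<or> b \<in> contraction S f Q"
      using contraction_mult[OF Q _ b] a s ab by simp
    then show ?thesis
      using contraction_mult[OF Q a] s by blast
  qed
  moreover have "ideal (contraction S f Q) S"
    using Q contraction_ideal by (simp add: prime_spectrum_def)
  ultimately show ?thesis
    using proper unfolding prime_spectrum_def by blast
qed

text \<open>The set \<open>N\<close> is the complement of a prime that the new prime should stay inside, or \<open>{\<one>}\<close>
  when there is no such constraint.\<close>

lemma exists_prime_over_Union:
  assumes L: "subset.chain (prime_spectrum R) L" "L \<noteq> {}"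
    and P: "P \<noteq> carrier S" "P \<subseteq> carrier S" "\<And>Q. Q \<in> L \<Longrightarrow> contraction S f Q \<subseteq> P"
    and N: "N \<subseteq> carrier R" "\<one>\<^bsub>R\<^esub> \<in> N"
      "\<And>x y. x \<in> N \<Longrightarrow> y \<in> N \<Longrightarrow> \<exists>r\<in>carrier R. x \<otimes>\<^bsub>R\<^esub> r \<otimes>\<^bsub>R\<^esub> y \<in> N"
      "\<And>Q. Q \<in> L \<Longrightarrow> Q \<inter> N = {}"
  shows "\<exists>Q\<in>prime_spectrum R. \<Union>L \<subseteq> Q \<and> Q \<inter> N = {} \<and> contraction S f Q = contraction S f (\<Union>L)"
proof -
  define A0 where "A0 = contraction S f (\<Union>L)"
  have A0P: "A0 \<subseteq> P"
    using P(3) by (auto simp: A0_def contraction_def)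
  have prime: "Q \<in> prime_spectrum R" if "Q \<in> L" for Q
    using L(1) that unfolding subset_chain_def by blast
  \<comment> \<open>The image of \<open>x y\<close> already lies in a single member of
    \<open>L\<close>, whose contraction decides between \<open>x\<close> and
    \<open>y\<close>.\<close>
  have A0_mult: "x \<in> A0 \<or> y \<in> A0"
    if xy: "x \<otimes>\<^bsub>S\<^esub> y \<in> A0" "x \<in> carrier S" "y \<in> carrier S" for x y
  proof -
    obtain Q where Q: "Q \<in> L" "x \<otimes>\<^bsub>S\<^esub> y \<in> contraction S f Q"
      using xy(1) by (auto simp: A0_def contraction_def)
    then have "contraction S f Q \<subseteq> A0" by (auto simp: A0_def contraction_def)
    then show ?thesis using contraction_mult[OF prime[OF Q(1)] xy(2,3) Q(2)] by blast
  qed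
  \<comment> \<open>The factors \<open>f t\<close> will force the new prime to contract to
    \<open>A0\<close>, the factors \<open>n\<close> will keep it away from \<open>N\<close>. It is
    an m-system because central factors can be collected on the left.\<close>
  define M where "M = {f t \<otimes>\<^bsub>R\<^esub> n | t n. t \<in> carrier S \<and> t \<notin> A0 \<and> n \<in> N}"
  \<comment> \<open>\<open>A0\<close> lies in the proper subset \<open>P\<close>, so
    \<open>M\<close> is nonempty.\<close>
  obtain t0 where t0: "t0 \<in> carrier S" "t0 \<notin> A0" using A0P P(1,2) by blast
  have MI: "f t \<otimes>\<^bsub>R\<^esub> n \<in> M" if "t \<in> carrier S" "t \<notin> A0" "n \<in> N" for t n
    using that by (auto simp: M_def)
  have "\<exists>Q\<in>prime_spectrum R. \<Union>L \<subseteq> Q \<and> Q \<inter> M = {}"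
  proof (rule R.exists_prime_disjoint_from_m_system)
    show "M \<subseteq> carrier R" using N(1) map_closed by (auto simp: M_def)
    show "M \<noteq> {}" using MI[OF t0 N(2)] by blast
  next
    fix x y assume "x \<in> M" "y \<in> M"
    then obtain t u m n where t: "t \<in> carrier S" "t \<notin> A0" and u: "u \<in> carrier S" "u \<notin> A0"
      and mn: "m \<in> N" "n \<in> N" and x: "x = f t \<otimes>\<^bsub>R\<^esub> m" and y: "y = f u \<otimes>\<^bsub>R\<^esub> n"
      by (auto simp: M_def)
    obtain r where r: "r \<in> carrier R" "m \<otimes>\<^bsub>R\<^esub> r \<otimes>\<^bsub>R\<^esub> n \<in> N" using N(3) mn by blast
    have mnR: "m \<in> carrier R" "n \<in> carrier R" using mn N(1) by auto
    have "x \<otimes>\<^bsub>R\<^esub> r \<otimes>\<^bsub>R\<^esub> y = f t \<otimes>\<^bsub>R\<^esub> ((m \<otimes>\<^bsub>R\<^esub> r) \<otimes>\<^bsub>R\<^esub> f u) \<otimes>\<^bsub>R\<^esub> n"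
      using mnR r t u map_closed by (simp add: x y R.m_assoc)
    also have "\<dots> = f (t \<otimes>\<^bsub>S\<^esub> u) \<otimes>\<^bsub>R\<^esub> (m \<otimes>\<^bsub>R\<^esub> r \<otimes>\<^bsub>R\<^esub> n)"
      using mnR r t u map_closed map_commute[of u "m \<otimes>\<^bsub>R\<^esub> r", symmetric]
      by (simp add: R.m_assoc map_mult)
    finally show "\<exists>r\<in>carrier R. x \<otimes>\<^bsub>R\<^esub> r \<otimes>\<^bsub>R\<^esub> y \<in> M"
      using MI[of "t \<otimes>\<^bsub>S\<^esub> u"] A0_mult t u r by (metis S.m_closed)
  next
    have "subset.chain {I. ideal I R} L"
      using L(1) unfolding subset_chain_def prime_spectrum_def by blast
    from R.chain_Union_is_ideal[OF this] show "ideal (\<Union>L) R" using L(2) by simp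
  next
    \<comment> \<open>As \<open>f t\<close> is central, the prime \<open>Q\<close> would contain
      \<open>f t\<close>, against the choice of \<open>t\<close>, or \<open>n\<close>, against its
      disjointness from \<open>N\<close>.\<close>
    have False if Q: "Q \<in> L" and t: "t \<in> carrier S" "t \<notin> A0" and n: "n \<in> N"
      and tn: "f t \<otimes>\<^bsub>R\<^esub> n \<in> Q" for Q t n
      using R.prime_spectrum_center_mult[OF prime[OF Q] map_center[OF t(1)] _ tn] n N(1) N(4)[OF Q] t Q
      by (auto simp: A0_def contraction_def)
    then show "\<Union>L \<inter> M = {}" by (auto simp: M_def)
  qed
  then obtain Q where Q: "Q \<in> prime_spectrum R" "\<Union>L \<subseteq> Q" "Q \<inter> M = {}" by blast
  have idl: "ideal Q R" using Q(1) by (simp add: prime_spectrum_def)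
  have "Q \<inter> N = {}"
  proof (rule ccontr)
    assume "Q \<inter> N \<noteq> {}"
    then obtain n where "n \<in> Q" "n \<in> N" by blast
    then show False
      using MI[OF t0] ideal.I_l_closed[OF idl] map_closed[OF t0(1)] Q(3) by blast
  qed
  moreover have "contraction S f Q = A0"
  proof
    show "A0 \<subseteq> contraction S f Q" using Q(2) by (auto simp: A0_def contraction_def)
    show "contraction S f Q \<subseteq> A0"
    proof
      \<comment> \<open>Here \<open>\<one>\<close> in \<open>N\<close> is used: if \<open>t\<close>
        were outside \<open>A0\<close>, then \<open>f t\<close> times \<open>\<one>\<close> would
        lie in \<open>M\<close>.\<close>
      fix t assume t: "t \<in> contraction S f Q"
      then have "f t \<otimes>\<^bsub>R\<^esub> \<one>\<^bsub>R\<^esub> \<in> Q" "t \<in> carrier S"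
        using map_closed by (auto simp: contraction_def)
      then show "t \<in> A0" using MI[OF _ _ N(2)] Q(3) by blast
    qed
  qed
  ultimately show ?thesis using Q by (auto simp: A0_def)
qed

section \<open>Inserting a prime between two chains\<close>

text \<open>Replacing \<open>L\<close> by one prime above it and \<open>U\<close> by its
  intersection reduces the task to at most two bounding primes. LO serves when both chains are
  empty, GD when only \<open>L\<close> is, GU when only \<open>U\<close> is, and SGB when neither
  is.\<close>

lemma exists_prime_between:
  assumes lo: "lying_over S R f" and gd: "going_down S R f" and gu: "going_up S R f"
    and sgb: "strong_going_between S R f"
    and L: "subset.chain (prime_spectrum R) L" and U: "subset.chain (prime_spectrum R) U"
    and LU: "\<And>Q Q'. Q \<in> L \<Longrightarrow> Q' \<in> U \<Longrightarrow> Q \<subseteq> Q'"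
    and P: "P \<in> prime_spectrum S"
    and LP: "\<And>Q. Q \<in> L \<Longrightarrow> contraction S f Q \<subset> P"
    and UP: "\<And>Q. Q \<in> U \<Longrightarrow> P \<subset> contraction S f Q"
    and Uproper: "\<And>Q. Q \<in> U \<Longrightarrow> contraction S f Q \<noteq> carrier S"
  shows "\<exists>Q\<in>prime_spectrum R. contraction S f Q = P \<and> (\<forall>Q'\<in>L. Q' \<subseteq> Q) \<and> (\<forall>Q'\<in>U. Q \<subseteq> Q')"
proof -
  have Psub: "P \<subseteq> carrier S" "P \<noteq> carrier S"
    using P ideal.axioms(1) additive_subgroup.a_subset unfolding prime_spectrum_def by blast+
  have below: "\<exists>Q\<in>prime_spectrum R. \<Union>L \<subseteq> Q \<and> Q \<inter> N = {} \<and>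
      contraction S f Q \<in> prime_spectrum S \<and> contraction S f Q \<subseteq> P"
    if nonempty: "L \<noteq> {}" and N: "N \<subseteq> carrier R" "\<one>\<^bsub>R\<^esub> \<in> N"
      "\<And>x y. x \<in> N \<Longrightarrow> y \<in> N \<Longrightarrow> \<exists>r\<in>carrier R. x \<otimes>\<^bsub>R\<^esub> r \<otimes>\<^bsub>R\<^esub> y \<in> N"
      "\<And>Q. Q \<in> L \<Longrightarrow> Q \<inter> N = {}" for N
  proof -
    obtain Q where Q: "Q \<in> prime_spectrum R" "\<Union>L \<subseteq> Q" "Q \<inter> N = {}"
      "contraction S f Q = contraction S f (\<Union>L)"
      using exists_prime_over_Union[OF L nonempty Psub(2,1) _ N] LP by blast
    moreover have "contraction S f (\<Union>L) \<subseteq> P"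
      using LP by (auto simp: contraction_def)
    ultimately show ?thesis
      using contraction_prime[OF Q(1)] Psub by (metis subset_antisym)
  qed
  have above: "\<Inter>U \<in> prime_spectrum R" "contraction S f (\<Inter>U) \<in> prime_spectrum S"
    "P \<subseteq> contraction S f (\<Inter>U)" if nonempty: "U \<noteq> {}"
  proof -
    show B: "\<Inter>U \<in> prime_spectrum R"
      by (rule R.prime_spectrum_Inter_chain[OF U nonempty])
    \<comment> \<open>A prime of \<open>R\<close> may contract to all of \<open>S\<close>. A single
      member of \<open>U\<close> with proper contraction rules this out for the
      intersection.\<close>
    obtain Q where Q: "Q \<in> U" using nonempty by blast
    then have "contraction S f (\<Inter>U) \<subseteq> contraction S f Q" "contraction S f Q \<subseteq> carrier S"
      by (auto simp: contraction_def)
    then have "contraction S f (\<Inter>U) \<noteq> carrier S"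
      using Uproper[OF Q] by blast
    then show "contraction S f (\<Inter>U) \<in> prime_spectrum S"
      by (rule contraction_prime[OF B])
    show "P \<subseteq> contraction S f (\<Inter>U)"
      using UP Psub(1) by (fastforce simp: contraction_def)
  qed
  consider (neither) "L = {}" "U = {}" | (upper) "L = {}" "U \<noteq> {}" | (lower) "L \<noteq> {}" "U = {}"
    | (both) "L \<noteq> {}" "U \<noteq> {}" by blast
  then show ?thesis
  proof cases
    case neither
    then show ?thesis
      using lo P unfolding lying_over_def lies_over_def by auto
  next
    case upper
    note B = above[OF \<open>U \<noteq> {}\<close>]
    \<comment> \<open>Every member of \<open>U\<close> contracts strictly above \<open>P\<close>,
      yet the intersection may contract to \<open>P\<close> itself. It is then the prime sought;
      otherwise GD applies. The same dichotomy occurs for \<open>A\<close> below.\<close>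
    obtain Q where "Q \<in> prime_spectrum R" "Q \<subseteq> \<Inter>U" "contraction S f Q = P"
    proof (cases "P = contraction S f (\<Inter>U)")
      case True
      then show ?thesis using that B by blast
    next
      case False
      then show ?thesis
        using that gd P B unfolding going_down_def lies_over_def by (metis psubset_eq)
    qed
    then show ?thesis using upper by blast
  next
    case lower
    \<comment> \<open>Disjointness from the set of \<open>\<one>\<close> alone expresses
      properness.\<close>
    have "Q \<inter> {\<one>\<^bsub>R\<^esub>} = {}" if "Q \<in> L" for Q
      using L that ideal.one_imp_carrier
      unfolding subset_chain_def prime_spectrum_def by blast
    then obtain A where A: "A \<in> prime_spectrum R" "\<Union>L \<subseteq> A"
      "contraction S f A \<in> prime_spectrum S" "contraction S f A \<subseteq> P"
      using below[OF lower(1), of "{\<one>\<^bsub>R\<^esub>}"] by auto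
    obtain Q where "Q \<in> prime_spectrum R" "A \<subseteq> Q" "contraction S f Q = P"
    proof (cases "contraction S f A = P")
      case True
      then show ?thesis using that A by blast
    next
      case False
      then show ?thesis
        using that gu P A unfolding going_up_def lies_over_def by (metis psubset_eq)
    qed
    then show ?thesis using lower A(2) by blast
  next
    case both
    note B = above[OF \<open>U \<noteq> {}\<close>]
    then have Bidl: "ideal (\<Inter>U) R" "\<Inter>U \<noteq> carrier R"
      and Bprime: "\<And>a b. \<lbrakk>a \<in> carrier R; b \<in> carrier R; \<forall>r\<in>carrier R. a \<otimes>\<^bsub>R\<^esub> r \<otimes>\<^bsub>R\<^esub> b \<in> \<Inter>U\<rbrakk>
        \<Longrightarrow> a \<in> \<Inter>U \<or> b \<in> \<Inter>U"
      unfolding prime_spectrum_def by blast+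
    have "\<exists>A\<in>prime_spectrum R. \<Union>L \<subseteq> A \<and> A \<inter> (carrier R - \<Inter>U) = {} \<and>
      contraction S f A \<in> prime_spectrum S \<and> contraction S f A \<subseteq> P"
    proof (rule below[OF both(1)])
      show "\<one>\<^bsub>R\<^esub> \<in> carrier R - \<Inter>U"
        using ideal.one_imp_carrier[OF Bidl(1)] Bidl(2) by blast
    next
      \<comment> \<open>That the complement is an m-system is primeness of \<open>\<Inter>U\<close>
        read contrapositively.\<close>
      fix x y assume "x \<in> carrier R - \<Inter>U" "y \<in> carrier R - \<Inter>U"
      then show "\<exists>r\<in>carrier R. x \<otimes>\<^bsub>R\<^esub> r \<otimes>\<^bsub>R\<^esub> y \<in> carrier R - \<Inter>U"
        using Bprime[of x y] R.m_closed by (metis DiffD1 DiffD2 DiffI)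
    next
      fix Q assume "Q \<in> L"
      then show "Q \<inter> (carrier R - \<Inter>U) = {}" using LU by blast
    qed blast
    then obtain A where A: "A \<in> prime_spectrum R" "\<Union>L \<subseteq> A" "A \<inter> (carrier R - \<Inter>U) = {}"
      "contraction S f A \<in> prime_spectrum S" "contraction S f A \<subseteq> P" by blast
    have "A \<subseteq> carrier R"
      using A(1) ideal.axioms(1) additive_subgroup.a_subset unfolding prime_spectrum_def by blast
    then have AB: "A \<subseteq> \<Inter>U" using A(3) by blast
    \<comment> \<open>If neither end contracts to \<open>P\<close>, both inclusions of contractions
      are strict. This makes \<open>A\<close> differ from \<open>\<Inter>U\<close>, as SGB
      requires.\<close>
    obtain Q where "Q \<in> prime_spectrum R" "A \<subseteq> Q" "Q \<subseteq> \<Inter>U" "contraction S f Q = P"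
    proof (cases "contraction S f A = P \<or> contraction S f (\<Inter>U) = P")
      case True
      then show ?thesis using that A B AB by blast
    next
      case False
      then have "contraction S f A \<subset> P" "P \<subset> contraction S f (\<Inter>U)"
        using A(5) B(3) by auto
      moreover from this have "A \<subset> \<Inter>U"
        using AB by auto
      ultimately obtain Q where "Q \<in> prime_spectrum R" "A \<subset> Q" "Q \<subset> \<Inter>U" "contraction S f Q = P"
        using sgb[unfolded strong_going_between_def lies_over_def, rule_format,
            of "contraction S f A" P "contraction S f (\<Inter>U)" A "\<Inter>U"] P A(1,4) B(1,2)
        by blast
      then show ?thesis using that by blast
    qed
    then show ?thesis using A(2) by blast
  qed
qed

section \<open>Maximal \<open>D\<close>-chains and their existence\<close>

lemma maximal_chain_over_perfect:
  assumes lo: "lying_over S R f" and inc: "incomparability S R f" and gd: "going_down S R f"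
    and gu: "going_up S R f" and sgb: "strong_going_between S R f"
    and D: "subset.chain (prime_spectrum S) D"
    and C: "maximal_chain_over S R f D C"
  shows "perfect_maximal_cover S R f D C"
proof -
  have chain: "C \<subseteq> prime_spectrum R" "\<And>Q Q'. Q \<in> C \<Longrightarrow> Q' \<in> C \<Longrightarrow> Q \<subseteq> Q' \<or> Q' \<subseteq> Q"
    and CD: "\<And>Q. Q \<in> C \<Longrightarrow> contraction S f Q \<in> D"
    and C_over: "chain_over S R f D C"
    and maximal: "\<And>C'. chain_over S R f D C' \<Longrightarrow> \<not> C \<subset> C'"
    using C unfolding maximal_chain_over_def chain_over_def subset_chain_def by blast+
  \<comment> \<open>INC speaks only of a larger prime with proper contraction; members of
    \<open>D\<close> are prime, hence proper.\<close>
  have proper: "contraction S f Q \<noteq> carrier S" if "Q \<in> C" for Q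
    using CD[OF that] D unfolding subset_chain_def prime_spectrum_def by blast
  have inj: "inj_on (contraction S f) C"
  proof (rule inj_onI, rule ccontr)
    fix Q Q' assume "Q \<in> C" "Q' \<in> C" "contraction S f Q = contraction S f Q'" "Q \<noteq> Q'"
    then show False
      using chain proper inc unfolding incomparability_def by (metis psubset_eq subsetD)
  qed
  have "P \<in> contraction S f ` C" if PD: "P \<in> D" for P
  proof (rule ccontr)
    assume missed: "P \<notin> contraction S f ` C"
    define L where "L = {Q \<in> C. contraction S f Q \<subset> P}"
    define U where "U = {Q \<in> C. P \<subset> contraction S f Q}"
    \<comment> \<open>\<open>D\<close> is a chain, so every contraction is comparable with
      \<open>P\<close>, and equality is excluded by \<open>missed\<close>.\<close>
    have split: "C = L \<union> U"
      using missed CD PD D unfolding L_def U_def subset_chain_def by blast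
    have mono: "contraction S f Q \<subseteq> contraction S f Q'" if "Q \<subseteq> Q'" for Q Q'
      using that by (auto simp: contraction_def)
    \<comment> \<open>The opposite inclusion would give, by monotonicity, a contraction above
      \<open>P\<close> inside one below \<open>P\<close>.\<close>
    have LU: "Q \<subseteq> Q'" if "Q \<in> L" "Q' \<in> U" for Q Q'
      using that chain(2) mono[of Q' Q] unfolding L_def U_def by blast
    have "\<exists>Q\<in>prime_spectrum R. contraction S f Q = P \<and> (\<forall>Q'\<in>L. Q' \<subseteq> Q) \<and> (\<forall>Q'\<in>U. Q \<subseteq> Q')"
    proof (rule exists_prime_between[OF lo gd gu sgb])
      show "subset.chain (prime_spectrum R) L" "subset.chain (prime_spectrum R) U"
        using chain unfolding L_def U_def subset_chain_def by blast+
      show "P \<in> prime_spectrum S" using PD D unfolding subset_chain_def by blast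
    qed (use LU proper in \<open>auto simp: L_def U_def\<close>)
    then obtain Q where Q: "Q \<in> prime_spectrum R" "contraction S f Q = P"
      "\<forall>Q'\<in>L. Q' \<subseteq> Q" "\<forall>Q'\<in>U. Q \<subseteq> Q'" by blast
    have "chain_over S R f D (insert Q C)"
      using Q chain CD PD split unfolding chain_over_def subset_chain_def by blast
    moreover have "C \<subset> insert Q C"
      using missed Q(2) by blast
    ultimately show False using maximal by blast
  qed
  then have onto: "contraction S f ` C = D" using CD by blast
  \<comment> \<open>Every cover is a \<open>D\<close>-chain, so maximality among
    \<open>D\<close>-chains passes to covers.\<close>
  then have "maximal_cover S R f D C"
    using C_over maximal unfolding maximal_cover_def cover_def by blast
  moreover have "perfect_cover S R f D C"
    using C_over inj onto unfolding perfect_cover_def bij_betw_def by blast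
  ultimately show ?thesis
    unfolding perfect_maximal_cover_def by blast
qed

end

text \<open>The condition on contractions concerns each prime separately, so \<open>D\<close>-chains
  are exactly the chains in one set \<open>?X\<close>, to which Hausdorff's principle
  applies.\<close>

lemma exists_maximal_chain_over: "\<exists>C. maximal_chain_over S R f D C"
proof -
  let ?X = "{Q \<in> prime_spectrum R. contraction S f Q \<in> D}"
  have "chain_over S R f D = subset.chain ?X"
    unfolding chain_over_def subset_chain_def by (intro ext) auto
  then have "maximal_chain_over S R f D = subset.maxchain ?X"
    by (simp add: fun_eq_iff maximal_chain_over_def subset.maxchain_def)
  then show ?thesis
    using subset.Hausdorff[of ?X] by simp
qed

theorem theorem2p13:
  fixes S :: "('a, 'm) ring_scheme" and R :: "('b, 'n) ring_scheme"
    and f :: "'a \<Rightarrow> 'b" and D :: "'a set set"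
  assumes "ring S" and "\<one>\<^bsub>S\<^esub> \<noteq> \<zero>\<^bsub>S\<^esub>"
    and "ring R" and "\<one>\<^bsub>R\<^esub> \<noteq> \<zero>\<^bsub>R\<^esub>"
    and "f \<in> nonunital_ring_hom S R"
    and "f ` carrier S \<subseteq> ring_center R"
    and "lying_over S R f"
    and "incomparability S R f"
    and "going_down S R f"
    and "going_up S R f"
    and "strong_going_between S R f"
    and "subset.chain (prime_spectrum S) D"
  shows "(\<exists>C. perfect_maximal_cover S R f D C) \<and>
         (\<forall>C. maximal_chain_over S R f D C \<longrightarrow> perfect_maximal_cover S R f D C)"
proof -
  interpret central_ring_hom S R f
    using assms(1,3,5,6) by (simp add: central_ring_hom_def central_ring_hom_axioms_def)
  show ?thesis
    using maximal_chain_over_perfect[OF assms(7-12)] exists_maximal_chain_over by blast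
qed

end
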